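(* Let $A_+\in\mathbb C^{n\times n}$ have stable subspace $\Sigma_+$ of dimension $k$, and let $\Omega_+\in\mathbb C^{n\times k}$ have orthonormal columns spanning $\Sigma_+$. Let $$\mathcal L\Omega:=(I-\Omega_+\Omega_+^* )A_+\Omega-\Omega\,\Omega_+^*A_+\Omega_+-\Omega_+\Omega^*A_+\Omega_+ ,\qquad \Omega\in\mathbb C^{n\times k},$$ regarded as a real-linear operator on $\mathbb C^{n\times k}$; $\Omega'=\mathcal L\Omega$ is the limiting constant-coefficient linearization, as $x\to+\infty$, of the continuous orthogonalization equation $\Omega'=(I-\Omega\Omega^* )A\Omega$ about a solution $\bar\Omega\to\Omega_+$ lying on the Stiefel manifold $\mathcal S=\{\Omega:\Omega^*\Omega=I_k\}$. Then: (a) the tangent space $T=\{\Omega:\Omega_+^*\Omega+\Omega^*\Omega_+=0\}$ of $\mathcal S$ at $\Omega_+$ is invariant under $\mathcal L$, the eigenvalues of $\mathcal L|_T$ have either zero or positive real part, and $\Omega'=\mathcal L\Omega$ restricted to $T$ is (neutrally) stable in backward $x$; (b) the remaining (transverse to $T$) eigenvalues of $\mathcal L$ have either zero or positive real part, and the Stiefel manifold is (neutrally) stable in backward $x$ for the limiting system $\Omega'=\mathcal L\Omega$.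
   Context: $A=A(x)$ is a coefficient matrix with $A(x)\to A_+$ as $x\to+\infty$. The stable subspace of $A_+$ is the sum of the generalized eigenspaces for eigenvalues of negative real part; the remaining eigenvalues have nonnegative real part. Since $\mathcal L$ involves $\Omega^*$ it is only real-linear; its eigenvalues are those of its complexification (equivalently of the corresponding linear operator in the pair $(\Omega,\Omega^* )$). Transverse eigenvalues are the eigenvalues of the map induced by $\mathcal L$ on the quotient $\mathbb C^{n\times k}/T$. "(Neutrally) stable in backward $x$" means that solutions of the corresponding linear constant-coefficient system remain bounded as $x\to-\infty$; in (b) this refers to perturbations transverse to $T$. *)

theory Defs
  imports "HOL-Analysis.Analysis"
begin

text \<open>
  A complex \<open>n\<close> by \<open>k\<close> matrix is an element of \<^typ>\<open>complex^'k^'n\<close>.  The operators \<open>**\<close>, \<open>*v\<close>,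
  \<^const>\<open>vec.span\<close> and \<^const>\<open>vec.dim\<close> are taken over the scalar field \<open>complex\<close>, whereas
  \<^const>\<open>linear\<close>, \<^const>\<open>subspace\<close> and \<open>*\<^sub>R\<close> are the real notions.
\<close>

definition ctranspose :: "complex^'k^'n \<Rightarrow> complex^'n^'k" where
  "ctranspose M = (\<chi> i j. cnj (M $ j $ i))"

definition eigenvalue :: "complex^'n^'n \<Rightarrow> complex \<Rightarrow> bool" where
  "eigenvalue A \<mu> \<longleftrightarrow> (\<exists>v. v \<noteq> 0 \<and> A *v v = \<mu> *s v)"

text \<open>Powers are iterated, because \<open>*\<close> and \<open>^\<close> on nested vectors act componentwise.\<close>

definition generalized_eigenspace :: "complex^'n^'n \<Rightarrow> complex \<Rightarrow> (complex^'n) set" where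
  "generalized_eigenspace A \<mu> = {v. \<exists>m. (((*v) (A - mat \<mu>)) ^^ m) v = 0}"

definition stable_subspace :: "complex^'n^'n \<Rightarrow> (complex^'n) set" where
  "stable_subspace A =
     vec.span (\<Union>\<mu>\<in>{\<mu>. eigenvalue A \<mu> \<and> Re \<mu> < 0}. generalized_eigenspace A \<mu>)"

definition stiefel :: "(complex^'k^'n) set" where
  "stiefel = {\<Omega>. ctranspose \<Omega> ** \<Omega> = mat 1}"

definition stiefel_tangent :: "complex^'k^'n \<Rightarrow> (complex^'k^'n) set" where
  "stiefel_tangent P = {\<Omega>. ctranspose P ** \<Omega> + ctranspose \<Omega> ** P = 0}"

definition orth_field :: "complex^'n^'n \<Rightarrow> complex^'k^'n \<Rightarrow> complex^'k^'n" where
  "orth_field A \<Omega> = (mat 1 - \<Omega> ** ctranspose \<Omega>) ** A ** \<Omega>"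

definition orth_lin :: "complex^'n^'n \<Rightarrow> complex^'k^'n \<Rightarrow> complex^'k^'n \<Rightarrow> complex^'k^'n" where
  "orth_lin A P \<Omega> =
     (mat 1 - P ** ctranspose P) ** A ** \<Omega>
     - \<Omega> ** ctranspose P ** A ** P
     - P ** ctranspose \<Omega> ** A ** P"

lemma linear_ctranspose: "linear ctranspose"
  by (rule linearI) (simp_all add: ctranspose_def vec_eq_iff)

lemma bounded_bilinear_cmatrix_mult:
  "bounded_bilinear ((**) :: complex^'m^'n \<Rightarrow> complex^'k^'m \<Rightarrow> complex^'k^'n)"
  unfolding bilinear_conv_bounded_bilinear [symmetric] bilinear_def
  by (auto intro!: linearI
      simp: matrix_matrix_mult_def vec_eq_iff algebra_simps sum.distrib scaleR_sum_right)

lemma orth_field_has_derivative: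
  "(orth_field A has_derivative orth_lin A P) (at P)"
proof -
  note mult = bounded_bilinear.FDERIV [OF bounded_bilinear_cmatrix_mult]
  have ct: "(ctranspose has_derivative ctranspose) (at P)"
    using linear_ctranspose
    by (intro bounded_linear_imp_has_derivative) (simp add: linear_conv_bounded_linear)
  have "(orth_field A has_derivative
      (\<lambda>\<Omega>. (mat 1 - P ** ctranspose P) ** A ** \<Omega>
        + ((0 - (P ** ctranspose \<Omega> + \<Omega> ** ctranspose P)) ** A
            + (mat 1 - P ** ctranspose P) ** 0) ** P)) (at P)"
    unfolding orth_field_def [abs_def]
    by (rule has_derivative_eq_rhs, rule mult, rule mult, rule has_derivative_diff,
        rule has_derivative_const, rule mult, rule has_derivative_ident, rule ct,
        rule has_derivative_const, rule has_derivative_ident)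
       (simp add: add.commute)
  moreover have "orth_lin A P = (\<lambda>\<Omega>. (mat 1 - P ** ctranspose P) ** A ** \<Omega>
        + ((0 - (P ** ctranspose \<Omega> + \<Omega> ** ctranspose P)) ** A
            + (mat 1 - P ** ctranspose P) ** 0) ** P)"
    by (simp add: fun_eq_iff orth_lin_def
        bounded_bilinear.minus_left [OF bounded_bilinear_cmatrix_mult]
        bounded_bilinear.diff_left [OF bounded_bilinear_cmatrix_mult]
        bounded_bilinear.add_left [OF bounded_bilinear_cmatrix_mult]
        bounded_bilinear.zero_right [OF bounded_bilinear_cmatrix_mult])
  ultimately show ?thesis by simp
qed

lemma linear_orth_lin: "linear (orth_lin A P)"
  using orth_field_has_derivative [of A P] by (rule has_derivative_linear)

lemma subspace_stiefel_tangent: "subspace (stiefel_tangent P)"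
proof -
  interpret m: bounded_bilinear "(**) :: complex^'n^'k \<Rightarrow> complex^'k^'n \<Rightarrow> complex^'k^'k"
    by (rule bounded_bilinear_cmatrix_mult)
  have "linear (\<lambda>\<Omega>. ctranspose P ** \<Omega> + ctranspose \<Omega> ** P)"
    by (rule linearI)
       (simp_all add: linear_add [OF linear_ctranspose] linear_scale [OF linear_ctranspose]
          m.add_left m.add_right m.scaleR_left m.scaleR_right scaleR_add_right)
  then show ?thesis
    unfolding stiefel_tangent_def by (rule linear_subspace_kernel)
qed

text \<open>
  Eigenvalues of the complexification of the restriction of a real-linear \<open>L\<close> to an invariant
  real subspace \<open>V\<close>: the pair \<open>(u, v)\<close> stands for the element \<open>u + \<i>v\<close> of the complexification
  of \<open>V\<close>, so the two equations are the real and imaginary parts of \<open>L (u + \<i>v) = \<mu> (u + \<i>v)\<close>.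
\<close>

definition restricted_eigenvalue ::
    "'a::real_vector set \<Rightarrow> ('a \<Rightarrow> 'a) \<Rightarrow> complex \<Rightarrow> bool" where
  "restricted_eigenvalue V L \<mu> \<longleftrightarrow>
     (\<exists>u\<in>V. \<exists>v\<in>V. (u, v) \<noteq> (0, 0) \<and>
        L u = Re \<mu> *\<^sub>R u - Im \<mu> *\<^sub>R v \<and>
        L v = Im \<mu> *\<^sub>R u + Re \<mu> *\<^sub>R v)"

text \<open>
  Elements of the quotient by a subspace \<open>T\<close> are the cosets \<open>coset_of T v\<close>.  The induced map
  is defined on a coset without choosing a representative; it is the coset of \<open>L v\<close>
  when \<open>T\<close> is invariant under \<open>L\<close>.
\<close>

definition coset_of :: "'a::real_vector set \<Rightarrow> 'a \<Rightarrow> 'a set" where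
  "coset_of T v = (\<lambda>t. v + t) ` T"

definition quotient_map :: "'a::real_vector set \<Rightarrow> ('a \<Rightarrow> 'a) \<Rightarrow> 'a set \<Rightarrow> 'a set" where
  "quotient_map T L X = (\<Union>x\<in>X. coset_of T (L x))"

lemma quotient_map_coset_of:
  assumes "subspace T" "linear L" "L ` T \<subseteq> T"
  shows "quotient_map T L (coset_of T v) = coset_of T (L v)"
proof (intro equalityI subsetI)
  fix y
  assume "y \<in> quotient_map T L (coset_of T v)"
  then obtain t s where ts: "t \<in> T" "s \<in> T" "y = L (v + t) + s"
    by (auto simp: quotient_map_def coset_of_def)
  then have "y = L v + (L t + s)" "L t + s \<in> T"
    using assms by (auto simp: linear_add add.assoc intro!: subspace_add)
  then show "y \<in> coset_of T (L v)"
    by (auto simp: coset_of_def)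
next
  fix y
  assume "y \<in> coset_of T (L v)"
  moreover have "v \<in> coset_of T v"
    using subspace_0 [OF assms(1)] by (force simp: coset_of_def)
  ultimately show "y \<in> quotient_map T L (coset_of T v)"
    by (auto simp: quotient_map_def)
qed

text \<open>
  Eigenvalues of the complexification of the map induced on the quotient of the whole space
  by \<open>T\<close>, with the same pair encoding.
\<close>

definition transverse_eigenvalue ::
    "'a::real_vector set \<Rightarrow> ('a \<Rightarrow> 'a) \<Rightarrow> complex \<Rightarrow> bool" where
  "transverse_eigenvalue T L \<mu> \<longleftrightarrow>
     (\<exists>u v. (coset_of T u, coset_of T v) \<noteq> (coset_of T 0, coset_of T 0) \<and>
        quotient_map T L (coset_of T u) = coset_of T (Re \<mu> *\<^sub>R u - Im \<mu> *\<^sub>R v) \<and>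
        quotient_map T L (coset_of T v) = coset_of T (Im \<mu> *\<^sub>R u + Re \<mu> *\<^sub>R v))"

definition backward_solution ::
    "('a::real_normed_vector \<Rightarrow> 'a) \<Rightarrow> real \<Rightarrow> (real \<Rightarrow> 'a) \<Rightarrow> bool" where
  "backward_solution L x0 \<Omega> \<longleftrightarrow>
     (\<forall>x\<le>x0. (\<Omega> has_vector_derivative L (\<Omega> x)) (at x within {..x0}))"

definition backward_stable_on :: "'a::real_normed_vector set \<Rightarrow> ('a \<Rightarrow> 'a) \<Rightarrow> bool" where
  "backward_stable_on V L \<longleftrightarrow>
     (\<forall>x0 \<Omega>. backward_solution L x0 \<Omega> \<and> (\<forall>x\<le>x0. \<Omega> x \<in> V) \<longrightarrow> bounded (\<Omega> ` {..x0}))"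

text \<open>
  Boundedness transverse to \<open>T\<close> is boundedness of the class of \<open>\<Omega> x\<close> modulo \<open>T\<close> in the
  quotient norm, which is the distance of \<open>\<Omega> x\<close> to \<open>T\<close>.  For invariant \<open>T\<close> in finite dimension
  these classes are exactly the solutions of the system induced on the quotient.
\<close>

definition backward_stable_transverse :: "'a::real_normed_vector set \<Rightarrow> ('a \<Rightarrow> 'a) \<Rightarrow> bool" where
  "backward_stable_transverse T L \<longleftrightarrow>
     (\<forall>x0 \<Omega>. backward_solution L x0 \<Omega> \<longrightarrow> bounded ((\<lambda>x. infdist (\<Omega> x) T) ` {..x0}))"

end

theory Submission
  imports Defs "HOL-Computational_Algebra.Fundamental_Theorem_Algebra"
begin

text \<open>
  Write \<open>P\<close> for the frame \<open>\<Omega>\<^sub>+\<close>, \<open>Q = I - P P\<^sup>*\<close> and \<open>B = P\<^sup>* A P\<close>.  Since the columns of \<open>P\<close> span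
  an invariant subspace, \<open>A P = P B\<close>, and the linearised equation decouples.  The part
  \<open>Y = Q \<Omega>\<close> solves the Sylvester equation \<open>Y' = (Q A Q) Y - Y B\<close>; the part \<open>P\<^sup>* \<Omega>\<close> changes at
  the rate \<open>- S B\<close>, where \<open>S = P\<^sup>* \<Omega> + \<Omega>\<^sup>* P\<close> measures the failure of \<open>\<Omega>\<close> to be tangent, and \<open>S\<close>
  itself solves the Sylvester equation \<open>S' = - B\<^sup>* S - S B\<close> (\<open>orth_lin_components\<close>,
  \<open>tangency_defect_orth_lin\<close>).  On the tangent space \<open>S = 0\<close>, so \<open>P\<^sup>* \<Omega>\<close> is constant and only \<open>Y\<close>
  moves; modulo the tangent space \<open>\<Omega>\<close> is determined by \<open>S\<close>.

  Both equations have the form \<open>Y' = C Y - Y B\<close> with every eigenvalue of \<open>C\<close> to the right of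
  every eigenvalue of \<open>B\<close>: the eigenvalues of \<open>B\<close> are those of \<open>A\<close> on the stable subspace,
  hence have negative real part, those of \<open>- B\<^sup>*\<close> are their reflections in the imaginary axis,
  and those of \<open>Q A Q\<close> are zero or belong to \<open>A\<close> modulo the stable subspace, hence have
  nonnegative real part (\<open>eigenvalue_compression\<close>, \<open>eigenvalue_uminus_ctranspose\<close>,
  \<open>eigenvalue_complement\<close>).  Such an equation is backward bounded
  (\<open>sylvester_backward_bounded\<close>).  No matrix exponential or Jordan form enters: some products
  of shifts \<open>C - \<gamma>\<^sub>i\<close> and \<open>B - \<beta>\<^sub>j\<close> over eigenvalues vanish, and stripping off the factors one at
  a time reduces the claim to the scalar equation \<open>y' = \<mu> y + z\<close> with \<open>z\<close> bounded and
  \<open>Re \<mu> > 0\<close>.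

  The statements on eigenvalues then follow from boundedness: an eigenvector \<open>u + \<i> v\<close> for
  \<open>\<mu>\<close> gives the solutions \<open>Re (e\<^bsup>\<mu>x\<^esup> (u + \<i> v))\<close> and \<open>Im (e\<^bsup>\<mu>x\<^esup> (u + \<i> v))\<close>, which cannot both be
  bounded as \<open>x \<rightarrow> - \<infinity>\<close> if \<open>Re \<mu> < 0\<close> (\<open>restricted_eigenvalue_nonneg\<close>).
\<close>

section \<open>Complex matrix algebra\<close>

lemmas cmatrix_simps =
  bounded_bilinear.add_left [OF bounded_bilinear_cmatrix_mult]
  bounded_bilinear.add_right [OF bounded_bilinear_cmatrix_mult]
  bounded_bilinear.diff_left [OF bounded_bilinear_cmatrix_mult]
  bounded_bilinear.diff_right [OF bounded_bilinear_cmatrix_mult]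
  bounded_bilinear.minus_left [OF bounded_bilinear_cmatrix_mult]
  bounded_bilinear.minus_right [OF bounded_bilinear_cmatrix_mult]
  bounded_bilinear.zero_left [OF bounded_bilinear_cmatrix_mult]
  bounded_bilinear.zero_right [OF bounded_bilinear_cmatrix_mult]
  bounded_bilinear.scaleR_left [OF bounded_bilinear_cmatrix_mult]
  bounded_bilinear.scaleR_right [OF bounded_bilinear_cmatrix_mult]

lemma mat_mult_entry: "(mat c ** (X :: complex^'k^'n)) $ i $ j = c * X $ i $ j"
  by (simp add: matrix_matrix_mult_def mat_def if_distrib[where f="\<lambda>x. x * _"] cong: if_cong)

lemma mult_mat_entry: "((X :: complex^'k^'n) ** mat c) $ i $ j = c * X $ i $ j"
  by (simp add: matrix_matrix_mult_def mat_def if_distrib[where f="\<lambda>x. _ * x"] cong: if_cong)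

lemma mult_mat_commute: "(X :: complex^'k^'n) ** mat c = mat c ** X"
  by (simp add: vec_eq_iff mat_mult_entry mult_mat_entry)

lemma mult_mat_left_commute:
  "(X :: complex^'m^'n) ** (mat c ** (Y :: complex^'k^'m)) = mat c ** (X ** Y)"
  by (simp add: matrix_mul_assoc mult_mat_commute)

lemma shift_left_commute:
  "((C :: complex^'n^'n) - mat c) ** (C ** (Y :: complex^'k^'n)) = C ** ((C - mat c) ** Y)"
  by (simp add: cmatrix_simps mult_mat_left_commute)

lemma mat_vector_mult: "mat c *v (x :: complex^'n) = c *s x"
  by (simp add: vec_eq_iff matrix_vector_mult_def mat_def if_distrib[where f="\<lambda>x. x * _"] cong: if_cong)

lemma mat_plus: "mat (a + b) = (mat a + mat b :: complex^'n^'n)"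
  by (simp add: vec_eq_iff mat_def)

lemma mat_times: "mat (a * b) = (mat a ** mat b :: complex^'n^'n)"
  by (simp add: vec_eq_iff mat_mult_entry, simp add: mat_def)

lemma mat_minus: "mat (- a) = (- mat a :: complex^'n^'n)"
  by (simp add: vec_eq_iff mat_def)

lemma mat_of_real_mult: "mat (of_real r) ** (X :: complex^'k^'n) = r *\<^sub>R X"
  by (simp add: vec_eq_iff mat_mult_entry, simp add: scaleR_conv_of_real)

lemma ctranspose_mult: "ctranspose (X ** Y) = ctranspose Y ** ctranspose X"
  by (simp add: ctranspose_def matrix_matrix_mult_def vec_eq_iff cnj_sum mult.commute)

lemma ctranspose_ctranspose [simp]: "ctranspose (ctranspose X) = X"
  by (simp add: ctranspose_def vec_eq_iff)

lemma ctranspose_mat [simp]: "ctranspose (mat c) = mat (cnj c)"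
  by (auto simp add: ctranspose_def vec_eq_iff mat_def)

lemmas ctranspose_simps = linear_add [OF linear_ctranspose] linear_diff [OF linear_ctranspose]
  linear_neg [OF linear_ctranspose] linear_0 [OF linear_ctranspose]
  linear_scale [OF linear_ctranspose] ctranspose_mult

section \<open>Annihilating products over the spectrum\<close>

lemma eigenvalue_iff_not_invertible: "eigenvalue M \<mu> \<longleftrightarrow> \<not> invertible (M - mat \<mu>)"
  unfolding eigenvalue_def invertible_left_inverse matrix_left_invertible_ker
  by (auto simp: matrix_vector_mult_diff_rdistrib mat_vector_mult)

text \<open>
  Each shift is peeled off on the right, so that an annihilated \<open>Y\<close> with first shift \<open>\<mu>\<close> hands
  down to \<open>(M - \<mu>) Y\<close>, which is annihilated by the shorter product.
\<close>

primrec shift_prod :: "complex^'n^'n \<Rightarrow> complex list \<Rightarrow> complex^'n^'n" where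
  "shift_prod M [] = mat 1"
| "shift_prod M (\<mu> # \<mu>s) = shift_prod M \<mu>s ** (M - mat \<mu>)"

lemma shift_prod_commute: "M ** shift_prod M \<mu>s = shift_prod M \<mu>s ** M"
proof (induction \<mu>s)
  case (Cons \<mu> \<mu>s)
  have "(M - mat \<mu>) ** M = M ** (M - mat \<mu>)"
    by (simp add: cmatrix_simps mult_mat_commute)
  with Cons show ?case
    by (metis matrix_mul_assoc shift_prod.simps(2))
qed simp

text \<open>
  Horner evaluation of \<open>p\<close> at \<open>M\<close> for the matrix product; \<open>poly p M\<close> would evaluate \<open>p\<close> in each
  entry, as \<open>*\<close> on nested vectors is componentwise.
\<close>

definition matrix_poly :: "complex^'n^'n \<Rightarrow> complex poly \<Rightarrow> complex^'n^'n" where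
  "matrix_poly M p = fold_coeffs (\<lambda>a X. mat a + M ** X) p 0"

lemma matrix_poly_0 [simp]: "matrix_poly M 0 = 0"
  by (simp add: matrix_poly_def)

lemma matrix_poly_pCons [simp]: "matrix_poly M (pCons a p) = mat a + M ** matrix_poly M p"
  by (cases "p = 0 \<and> a = 0") (auto simp: matrix_poly_def cmatrix_simps)

lemma matrix_poly_add: "matrix_poly M (p + q) = matrix_poly M p + matrix_poly M q"
  by (induction p q rule: poly_induct2) (simp_all add: cmatrix_simps mat_plus)

lemma matrix_poly_sum: "matrix_poly M (\<Sum>i\<in>I. f i) = (\<Sum>i\<in>I. matrix_poly M (f i))"
  by (induction I rule: infinite_finite_induct) (simp_all add: matrix_poly_add)

lemma matrix_poly_smult: "matrix_poly M (smult c p) = mat c ** matrix_poly M p"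
  by (induction p) (simp_all add: matrix_add_ldistrib mat_times mult_mat_left_commute cmatrix_simps)

lemma matrix_poly_monom:
  "matrix_poly M (monom c i) = mat c ** (((**) M ^^ i) (mat 1))"
  by (induction i) (simp_all add: monom_0 monom_Suc mult_mat_left_commute cmatrix_simps)

lemma matrix_poly_commute: "M ** matrix_poly M p = matrix_poly M p ** M"
proof (induction p)
  case (pCons a p)
  have "M ** (M ** matrix_poly M p) = (M ** matrix_poly M p) ** M"
    by (metis matrix_mul_assoc pCons.IH)
  then show ?case
    by (simp add: cmatrix_simps mult_mat_commute)
qed (simp add: cmatrix_simps)

lemma matrix_poly_root:
  "matrix_poly M ([:-z, 1:] * q) = (M - mat z) ** matrix_poly M q"
proof -
  have "[:-z, 1:] * q = smult (- z) q + pCons 0 q"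
    by simp
  then show ?thesis
    by (simp only: matrix_poly_add matrix_poly_smult matrix_poly_pCons mat_0 mat_minus cmatrix_simps)
       simp
qed

text \<open>
  The matrices form a finite-dimensional real space, so the powers \<open>M\<^sup>0, \<dots>, M\<^sup>d\<close> are linearly
  dependent once \<open>d\<close> reaches the dimension.
\<close>

lemma annihilating_poly_exists:
  fixes M :: "complex^'n^'n"
  shows "\<exists>p. p \<noteq> 0 \<and> matrix_poly M p = 0"
proof -
  define pow where "pow i = ((**) M ^^ i) (mat 1)" for i
  define d where "d = DIM(complex^'n^'n)"
  show ?thesis
  proof (cases "inj_on pow {..d}")
    case False
    then obtain i j where ij: "i \<noteq> j" "pow i = pow j"
      by (auto simp: inj_on_def)
    have "coeff (monom 1 i + monom (-1::complex) j) i \<noteq> 0"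
      using ij by simp
    then have "monom 1 i + monom (-1::complex) j \<noteq> 0"
      by (metis coeff_0)
    moreover have "matrix_poly M (monom 1 i + monom (-1) j) = 0"
      using ij by (simp add: matrix_poly_add matrix_poly_monom pow_def mat_minus cmatrix_simps)
    ultimately show ?thesis by blast
  next
    case True
    then have "card (pow ` {..d}) = Suc d"
      by (simp add: card_image)
    then have "dependent (pow ` {..d})"
      by (intro dependent_biggerset) (simp add: d_def)
    then obtain u i where i: "i \<le> d" "u (pow i) \<noteq> 0"
      and sum: "(\<Sum>v\<in>pow ` {..d}. u v *\<^sub>R v) = 0"
      by (auto simp: dependent_finite)
    define p where "p = (\<Sum>i\<le>d. monom (complex_of_real (u (pow i))) i)"
    have "coeff p i = u (pow i)"
      using i by (simp add: p_def coeff_sum)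
    then have "p \<noteq> 0" using i by auto
    moreover have "matrix_poly M p = (\<Sum>i\<le>d. u (pow i) *\<^sub>R pow i)"
      by (simp add: p_def matrix_poly_sum matrix_poly_monom mat_of_real_mult pow_def)
    then have "matrix_poly M p = 0"
      using sum by (simp add: sum.reindex [OF True])
    ultimately show ?thesis by blast
  qed
qed

text \<open>
  The polynomial is split into linear factors.  A factor \<open>M - z\<close> at a point \<open>z\<close> outside the
  spectrum is invertible and can be cancelled, so only eigenvalues are kept.  The right factor
  \<open>X\<close> lets the induction absorb the factors already kept.
\<close>

lemma shift_prod_of_poly:
  fixes X :: "complex^'k^'n"
  assumes "p \<noteq> 0" "matrix_poly M p ** X = 0"
  shows "\<exists>\<mu>s. (\<forall>\<mu>\<in>set \<mu>s. eigenvalue M \<mu>) \<and> shift_prod M \<mu>s ** X = 0"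
  using assms
proof (induction "degree p" arbitrary: p X)
  case 0
  then obtain c where "p = [:c:]"
    by (metis degree_eq_zeroE)
  with 0 have "c \<noteq> 0" "mat c ** X = 0"
    by (auto simp: cmatrix_simps)
  then have "X = 0"
    by (auto simp: vec_eq_iff mat_mult_entry dest!: spec)
  then show ?case
    by (intro exI[of _ "[]"]) (simp add: cmatrix_simps)
next
  case (Suc d)
  have "\<not> constant (poly p)"
    using Suc.hyps(2) by (simp add: constant_degree)
  then obtain z where "poly p z = 0"
    using fundamental_theorem_of_algebra by blast
  then obtain q where p: "p = [:-z, 1:] * q"
    by (metis poly_eq_0_iff_dvd dvdE)
  with Suc.prems have "q \<noteq> 0" by auto
  then have deg: "d = degree q"
    using Suc.hyps(2) unfolding p by (subst (asm) degree_mult_eq) auto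
  show ?case
  proof (cases "eigenvalue M z")
    case True
    have "(M - mat z) ** matrix_poly M q = matrix_poly M q ** (M - mat z)"
      by (simp add: cmatrix_simps matrix_poly_commute mult_mat_commute)
    then have "matrix_poly M q ** ((M - mat z) ** X) = 0"
      using Suc.prems(2) unfolding p matrix_poly_root by (simp add: matrix_mul_assoc)
    from Suc.hyps(1) [OF deg \<open>q \<noteq> 0\<close> this] obtain \<mu>s
      where "\<forall>\<mu>\<in>set \<mu>s. eigenvalue M \<mu>" "shift_prod M \<mu>s ** ((M - mat z) ** X) = 0" by blast
    then show ?thesis
      using True by (intro exI[of _ "z # \<mu>s"]) (simp add: matrix_mul_assoc)
  next
    case False
    then obtain N where N: "N ** (M - mat z) = mat 1"
      by (auto simp: eigenvalue_iff_not_invertible invertible_left_inverse)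
    have "matrix_poly M q ** X = N ** (matrix_poly M p ** X)"
      unfolding p matrix_poly_root by (simp only: matrix_mul_assoc N matrix_mul_lid)
    also have "\<dots> = 0"
      using Suc.prems(2) by (simp add: cmatrix_simps)
    finally show ?thesis
      using Suc.hyps(1) [OF deg \<open>q \<noteq> 0\<close>] by blast
  qed
qed

lemma spectral_annihilator:
  obtains \<mu>s where "\<forall>\<mu>\<in>set \<mu>s. eigenvalue M \<mu>" "shift_prod M \<mu>s = 0"
proof -
  obtain p where "p \<noteq> 0" "matrix_poly M p ** mat 1 = 0"
    using annihilating_poly_exists [of M] by auto
  from shift_prod_of_poly [OF this] that show ?thesis by auto
qed

section \<open>Boundedness of Sylvester flows\<close>

text \<open>
  With \<open>v = e\<^bsup>- \<mu> x\<^esup> y\<close> the derivative \<open>v' = e\<^bsup>- \<mu> x\<^esup> z\<close> is dominated by the derivative of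
  \<open>- (W / Re \<mu>) e\<^bsup>- Re \<mu> x\<^esup>\<close>, where \<open>W\<close> bounds \<open>z\<close>.  The mean value inequality bounds the
  increment of \<open>v\<close>, and multiplying by \<open>e\<^bsup>Re \<mu> x\<^esup>\<close>, which is bounded for \<open>x \<le> x\<^sub>0\<close>, bounds \<open>y\<close>.
\<close>

lemma scalar_backward_bounded:
  fixes y z :: "real \<Rightarrow> complex"
  assumes l: "Re \<mu> > 0"
    and y: "\<And>x. x \<le> x0 \<Longrightarrow> (y has_vector_derivative \<mu> * y x + z x) (at x within {..x0})"
    and z: "bounded (z ` {..x0})"
  shows "bounded (y ` {..x0})"
proof -
  obtain W where W: "\<And>x. x \<le> x0 \<Longrightarrow> norm (z x) \<le> W"
    using z by (auto simp: bounded_iff)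
  define e where "e x = exp (- \<mu> * of_real x)" for x
  have e: "(e has_vector_derivative - \<mu> * e x) (at x within S)" for x S
    unfolding e_def
    by (rule has_vector_derivative_eq_rhs, rule has_vector_derivative_real_field)
       (auto intro!: derivative_eq_intros)
  have norm_e: "norm (e x) = exp (- Re \<mu> * x)" for x
    by (simp add: e_def)
  define v where "v x = e x * y x" for x
  have v: "(v has_vector_derivative e x * z x) (at x within {..x0})" if "x \<le> x0" for x
    unfolding v_def
    by (rule has_vector_derivative_eq_rhs, rule has_vector_derivative_mult, rule e, rule y[OF that])
       (simp add: algebra_simps)
  define \<phi> where "\<phi> t = - (W / Re \<mu>) * exp (- Re \<mu> * t)" for t
  have \<phi>: "(\<phi> has_vector_derivative W * exp (- Re \<mu> * t)) (at t within S)" for t S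
    unfolding \<phi>_def has_real_derivative_iff_has_vector_derivative [symmetric]
    using l by (auto intro!: derivative_eq_intros)
  have "norm (y x) \<le> norm (v x0) * exp (Re \<mu> * x0) + W / Re \<mu>" if x: "x \<le> x0" for x
  proof -
    have "norm (v x0 - v x) \<le> \<phi> x0 - \<phi> x"
    proof (cases "x = x0")
      case False
      then have "x < x0" using x by simp
      then show ?thesis
      proof (rule differentiable_bound_general)
        show "continuous_on {x..x0} \<phi>"
          using \<phi> by (meson has_vector_derivative_continuous continuous_on_eq_continuous_within)
        show "continuous_on {x..x0} v"
          unfolding continuous_on_eq_continuous_within
          by (auto intro!: has_vector_derivative_continuous
              [OF has_vector_derivative_within_subset [OF v]])
        fix t assume t: "x < t" "t < x0"
        show "(\<phi> has_vector_derivative W * exp (- Re \<mu> * t)) (at t)" by (rule \<phi>)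
        have "at t within {..x0} = at t"
          using t by (intro at_within_interior) auto
        then show "(v has_vector_derivative e t * z t) (at t)"
          using v [of t] t by simp
        show "norm (e t * z t) \<le> W * exp (- Re \<mu> * t)"
          using W [of t] t by (simp add: norm_mult norm_e mult.commute)
      qed
    qed auto
    moreover have "norm (v x) \<le> norm (v x0) + norm (v x0 - v x)"
      by (metis norm_minus_commute norm_triangle_sub)
    moreover have "W \<ge> 0"
      using W [of x0] by (meson norm_ge_zero order_trans order_refl)
    then have "\<phi> x0 \<le> 0"
      using l by (simp add: \<phi>_def)
    ultimately have "norm (v x) \<le> norm (v x0) + W / Re \<mu> * exp (- Re \<mu> * x)"
      by (simp add: \<phi>_def)
    then have "exp (Re \<mu> * x) * norm (v x)
        \<le> exp (Re \<mu> * x) * (norm (v x0) + W / Re \<mu> * exp (- Re \<mu> * x))"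
      by simp
    moreover have "exp (Re \<mu> * x) * norm (v x) = norm (y x)"
      by (simp add: v_def norm_mult norm_e exp_minus)
    moreover have "exp (Re \<mu> * x) * (norm (v x0) + W / Re \<mu> * exp (- Re \<mu> * x))
        = norm (v x0) * exp (Re \<mu> * x) + W / Re \<mu>"
      by (simp add: algebra_simps exp_minus)
    moreover have "norm (v x0) * exp (Re \<mu> * x) \<le> norm (v x0) * exp (Re \<mu> * x0)"
      using x l by (intro mult_left_mono) auto
    ultimately show ?thesis by linarith
  qed
  then show ?thesis by (auto simp: bounded_iff)
qed

lemma bounded_matrix_iff:
  fixes Y :: "'a \<Rightarrow> complex^'k^'n"
  shows "bounded (Y ` S) \<longleftrightarrow> (\<forall>i j. bounded ((\<lambda>x. Y x $ i $ j) ` S))"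
proof
  assume "bounded (Y ` S)"
  then obtain b where b: "\<forall>x\<in>S. norm (Y x) \<le> b" by (auto simp: bounded_iff)
  have "norm (Y x $ i $ j) \<le> norm (Y x)" for x i j
    by (rule order_trans [OF Finite_Cartesian_Product.norm_nth_le Finite_Cartesian_Product.norm_nth_le])
  with b have "\<forall>x\<in>S. norm (Y x $ i $ j) \<le> b" for i j
    by (blast intro: order_trans)
  then show "\<forall>i j. bounded ((\<lambda>x. Y x $ i $ j) ` S)"
    by (auto simp: bounded_iff)
next
  assume "\<forall>i j. bounded ((\<lambda>x. Y x $ i $ j) ` S)"
  then have "\<forall>i j. \<exists>b. \<forall>x\<in>S. norm (Y x $ i $ j) \<le> b" by (auto simp: bounded_iff)
  then obtain b where b: "\<And>i j x. x \<in> S \<Longrightarrow> norm (Y x $ i $ j) \<le> b i j" by metis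
  have "norm (Y x) \<le> (\<Sum>i\<in>UNIV. \<Sum>j\<in>UNIV. b i j)" if "x \<in> S" for x
  proof -
    have "norm (Y x) \<le> (\<Sum>i\<in>UNIV. norm (Y x $ i))"
      unfolding norm_vec_def by (rule L2_set_le_sum) simp
    also have "\<dots> \<le> (\<Sum>i\<in>UNIV. \<Sum>j\<in>UNIV. norm (Y x $ i $ j))"
      by (intro sum_mono) (simp add: norm_vec_def L2_set_le_sum)
    also have "\<dots> \<le> (\<Sum>i\<in>UNIV. \<Sum>j\<in>UNIV. b i j)"
      by (intro sum_mono b that)
    finally show ?thesis .
  qed
  then show "bounded (Y ` S)" by (auto simp: bounded_iff)
qed

lemma bounded_matrix_mult:
  fixes Y :: "'a \<Rightarrow> complex^'k^'n" and C :: "complex^'n^'m"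
  assumes "bounded (Y ` S)"
  shows "bounded ((\<lambda>x. C ** Y x) ` S)"
proof -
  have "bounded ((**) C ` (Y ` S))"
    by (rule bounded_linear_image [OF assms])
       (rule bounded_bilinear.bounded_linear_right [OF bounded_bilinear_cmatrix_mult])
  then show ?thesis by (simp add: image_image)
qed

lemmas cmatrix_mult_derivative =
  bounded_linear.has_vector_derivative
    [OF bounded_bilinear.bounded_linear_right [OF bounded_bilinear_cmatrix_mult]]
  bounded_linear.has_vector_derivative
    [OF bounded_bilinear.bounded_linear_left [OF bounded_bilinear_cmatrix_mult]]

text \<open>
  If \<open>\<gamma>\<close> is the first shift, \<open>W = (C - \<gamma>) Y\<close> solves an equation of the same kind and is annihilated
  by the remaining shifts, hence is bounded by induction.  Then \<open>Y' = (\<gamma> - \<beta>) Y + W + Z\<close> is a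
  scalar equation in each entry.
\<close>

lemma forced_backward_bounded:
  fixes C :: "complex^'n^'n" and Y Z :: "real \<Rightarrow> complex^'k^'n"
  assumes "\<And>x. x \<le> x0 \<Longrightarrow>
      (Y has_vector_derivative C ** Y x - mat \<beta> ** Y x + Z x) (at x within {..x0})"
    and "bounded (Z ` {..x0})"
    and "\<And>x. x \<le> x0 \<Longrightarrow> shift_prod C \<gamma>s ** Y x = 0"
    and "\<forall>\<gamma>\<in>set \<gamma>s. Re \<beta> < Re \<gamma>"
  shows "bounded (Y ` {..x0})"
  using assms
proof (induction \<gamma>s arbitrary: Y Z)
  case Nil
  then have "Y ` {..x0} \<subseteq> {0}" by auto
  then show ?case by (rule bounded_subset [rotated]) simp
next
  case (Cons \<gamma> \<gamma>s)
  define W where "W x = (C - mat \<gamma>) ** Y x" for x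
  have "bounded (W ` {..x0})"
  proof (rule Cons.IH)
    fix x assume x: "x \<le> x0"
    show "(W has_vector_derivative C ** W x - mat \<beta> ** W x + (C - mat \<gamma>) ** Z x) (at x within {..x0})"
      unfolding W_def
      by (rule has_vector_derivative_eq_rhs, rule cmatrix_mult_derivative(1), rule Cons.prems(1)[OF x])
         (simp only: matrix_add_ldistrib bounded_bilinear.diff_right [OF bounded_bilinear_cmatrix_mult]
           mult_mat_left_commute shift_left_commute)
    show "shift_prod C \<gamma>s ** W x = 0"
      using Cons.prems(3) [OF x] by (simp add: W_def matrix_mul_assoc)
  qed (use Cons.prems in \<open>auto intro: bounded_matrix_mult\<close>)
  then have WZ: "bounded ((\<lambda>x. W x + Z x) ` {..x0})"
    using Cons.prems(2) by (rule bounded_plus_comp)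
  show ?case
    unfolding bounded_matrix_iff
  proof (intro allI)
    fix i j
    show "bounded ((\<lambda>x. Y x $ i $ j) ` {..x0})"
    proof (rule scalar_backward_bounded)
      show "0 < Re (\<gamma> - \<beta>)" using Cons.prems(4) by simp
      show "bounded ((\<lambda>x. (W x + Z x) $ i $ j) ` {..x0})"
        using WZ unfolding bounded_matrix_iff by blast
      fix x assume x: "x \<le> x0"
      have "bounded_linear (\<lambda>M :: complex^'k^'n. M $ i $ j)"
        by (rule bounded_linear_compose [OF bounded_linear_vec_nth [of j] bounded_linear_vec_nth [of i]])
      from bounded_linear.has_vector_derivative [OF this Cons.prems(1) [OF x]]
      show "((\<lambda>x. Y x $ i $ j) has_vector_derivative (\<gamma> - \<beta>) * Y x $ i $ j + (W x + Z x) $ i $ j)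
          (at x within {..x0})"
        by (simp add: W_def cmatrix_simps mat_mult_entry algebra_simps)
    qed
  qed
qed

text \<open>
  The same induction on the right factor: \<open>Z = Y (B - \<beta>)\<close> solves the same equation with fewer
  shifts left, and \<open>Y B = \<beta> Y + Z\<close> turns the equation for \<open>Y\<close> into a forced one.
\<close>

lemma sylvester_backward_bounded_aux:
  fixes C :: "complex^'n^'n" and B :: "complex^'k^'k" and Y :: "real \<Rightarrow> complex^'k^'n"
  assumes "\<And>x. x \<le> x0 \<Longrightarrow> (Y has_vector_derivative C ** Y x - Y x ** B) (at x within {..x0})"
    and C: "shift_prod C \<gamma>s = 0"
    and "\<And>x. x \<le> x0 \<Longrightarrow> Y x ** shift_prod B \<beta>s = 0"
    and "\<forall>\<beta>\<in>set \<beta>s. \<forall>\<gamma>\<in>set \<gamma>s. Re \<beta> < Re \<gamma>"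
  shows "bounded (Y ` {..x0})"
  using assms(1,3,4)
proof (induction \<beta>s arbitrary: Y)
  case Nil
  then have "Y ` {..x0} \<subseteq> {0}" by auto
  then show ?case by (rule bounded_subset [rotated]) simp
next
  case (Cons \<beta> \<beta>s)
  define Z where "Z x = Y x ** (B - mat \<beta>)" for x
  have "bounded (Z ` {..x0})"
  proof (rule Cons.IH)
    fix x assume x: "x \<le> x0"
    show "(Z has_vector_derivative C ** Z x - Z x ** B) (at x within {..x0})"
      unfolding Z_def
      by (rule has_vector_derivative_eq_rhs, rule cmatrix_mult_derivative(2), rule Cons.prems(1)[OF x])
         (simp add: cmatrix_simps mult_mat_commute matrix_mul_assoc)
    have "(B - mat \<beta>) ** shift_prod B \<beta>s = shift_prod B \<beta>s ** (B - mat \<beta>)"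
      by (simp add: cmatrix_simps shift_prod_commute mult_mat_commute)
    then show "Z x ** shift_prod B \<beta>s = 0"
      using Cons.prems(2) [OF x] by (simp add: Z_def matrix_mul_assoc [symmetric])
  qed (use Cons.prems in auto)
  then have Z: "bounded ((\<lambda>x. - Z x) ` {..x0})"
    by (auto simp: bounded_iff)
  show ?case
  proof (rule forced_backward_bounded [OF _ Z])
    fix x assume x: "x \<le> x0"
    show "(Y has_vector_derivative C ** Y x - mat \<beta> ** Y x + - Z x) (at x within {..x0})"
      by (rule has_vector_derivative_eq_rhs, rule Cons.prems(1)[OF x])
         (simp add: Z_def cmatrix_simps mult_mat_commute)
    show "shift_prod C \<gamma>s ** Y x = 0" by (simp add: C cmatrix_simps)
  qed (use Cons.prems in auto)
qed

lemma sylvester_backward_bounded: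
  fixes C :: "complex^'n^'n" and B :: "complex^'k^'k" and Y :: "real \<Rightarrow> complex^'k^'n"
  assumes "\<And>x. x \<le> x0 \<Longrightarrow> (Y has_vector_derivative C ** Y x - Y x ** B) (at x within {..x0})"
    and "\<And>\<beta> \<gamma>. eigenvalue B \<beta> \<Longrightarrow> eigenvalue C \<gamma> \<Longrightarrow> Re \<beta> < Re \<gamma>"
  shows "bounded (Y ` {..x0})"
proof -
  obtain \<gamma>s where "\<forall>\<gamma>\<in>set \<gamma>s. eigenvalue C \<gamma>" "shift_prod C \<gamma>s = 0"
    by (rule spectral_annihilator)
  moreover obtain \<beta>s where "\<forall>\<beta>\<in>set \<beta>s. eigenvalue B \<beta>" "shift_prod B \<beta>s = 0"
    by (rule spectral_annihilator)
  ultimately show ?thesis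
    using assms by (intro sylvester_backward_bounded_aux [of x0 Y C B \<gamma>s \<beta>s]) (auto simp: cmatrix_simps)
qed

section \<open>The spectrum on the stable subspace and off it\<close>

lemma funpow_mult_vector:
  fixes M :: "complex^'n^'n"
  shows "((*v) M ^^ m) (v + w) = ((*v) M ^^ m) v + ((*v) M ^^ m) w"
    and "((*v) M ^^ m) (c *s v) = c *s ((*v) M ^^ m) v"
    and "((*v) M ^^ m) 0 = 0"
  by (induction m) (simp_all add: matrix_vector_right_distrib vector_scalar_commute)

lemma funpow_mult_vector_commute:
  fixes M K :: "complex^'n^'n"
  assumes "M ** K = K ** M"
  shows "((*v) M ^^ m) (K *v v) = K *v ((*v) M ^^ m) v"
  by (induction m) (simp_all add: matrix_vector_mul_assoc assms)

lemma subspace_generalized_eigenspace: "vec.subspace (generalized_eigenspace A \<mu>)"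
proof (rule vec.subspaceI)
  fix v w c
  assume v: "v \<in> generalized_eigenspace A \<mu>" and w: "w \<in> generalized_eigenspace A \<mu>"
  let ?f = "(*v) (A - mat \<mu>)"
  from v w obtain i j where ij: "(?f ^^ i) v = 0" "(?f ^^ j) w = 0"
    by (auto simp: generalized_eigenspace_def)
  have "(?f ^^ (j + i)) v = 0" "(?f ^^ (i + j)) w = 0"
    using ij by (simp_all only: funpow_add o_apply funpow_mult_vector(3))
  then have "(?f ^^ (i + j)) v = 0" "(?f ^^ (i + j)) w = 0"
    by (simp_all only: add.commute)
  then show "v + w \<in> generalized_eigenspace A \<mu>"
    unfolding generalized_eigenspace_def
    by (intro CollectI exI [of _ "i + j"]) (simp only: funpow_mult_vector add_0)
  show "c *s v \<in> generalized_eigenspace A \<mu>"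
    unfolding generalized_eigenspace_def
    by (intro CollectI exI [of _ i]) (simp only: funpow_mult_vector ij(1) vector_smult_rzero)
next
  show "0 \<in> generalized_eigenspace A \<mu>"
    by (auto simp: generalized_eigenspace_def funpow_mult_vector)
qed

lemma generalized_eigenspace_invariant:
  assumes "v \<in> generalized_eigenspace A \<mu>"
  shows "A *v v \<in> generalized_eigenspace A \<mu>"
proof -
  have "(A - mat \<mu>) ** A = A ** (A - mat \<mu>)"
    by (simp add: cmatrix_simps mult_mat_commute)
  note commute = funpow_mult_vector_commute [OF this]
  obtain m where "((*v) (A - mat \<mu>) ^^ m) v = 0"
    using assms by (auto simp: generalized_eigenspace_def)
  then have "((*v) (A - mat \<mu>) ^^ m) (A *v v) = 0"
    by (simp only: commute matrix_vector_mult_0_right)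
  then show ?thesis
    unfolding generalized_eigenspace_def by blast
qed

text \<open>
  On the generalized eigenspace \<open>A - \<beta>\<close> is a nilpotent map plus the nonzero scalar \<open>\<mu> - \<beta>\<close>,
  hence invertible; the induction on the order of nilpotency sums the Neumann series.
\<close>

lemma generalized_eigenspace_shift_surj:
  assumes z: "z \<in> generalized_eigenspace A \<mu>" and "\<beta> \<noteq> \<mu>"
  shows "\<exists>w\<in>generalized_eigenspace A \<mu>. (A - mat \<beta>) *v w = z"
proof -
  let ?N = "A - mat \<mu>"
  obtain m where "(((*v) ?N) ^^ m) z = 0"
    using z by (auto simp: generalized_eigenspace_def)
  then show ?thesis
  proof (induction m arbitrary: z)
    case 0
    then show ?case
      by (auto intro!: bexI[of _ 0] vec.subspace_0 subspace_generalized_eigenspace)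
  next
    case (Suc m)
    then have "(((*v) ?N) ^^ m) (?N *v z) = 0"
      by (simp add: funpow_swap1)
    then obtain w where w: "w \<in> generalized_eigenspace A \<mu>" "(A - mat \<beta>) *v w = ?N *v z"
      using Suc.IH by blast
    have z: "z \<in> generalized_eigenspace A \<mu>"
      using Suc.prems unfolding generalized_eigenspace_def by blast
    have "(A - mat \<beta>) *v (z - w) = (\<mu> - \<beta>) *s z"
      by (simp add: matrix_vector_mult_diff_distrib w)
         (simp add: matrix_vector_mult_diff_rdistrib mat_vector_mult vector_sub_rdistrib)
    then have "(A - mat \<beta>) *v (inverse (\<mu> - \<beta>) *s (z - w)) = z"
      using assms(2) by (simp only: vector_scalar_commute vector_smult_assoc) simp
    moreover have "inverse (\<mu> - \<beta>) *s (z - w) \<in> generalized_eigenspace A \<mu>"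
      by (intro vec.subspace_scale vec.subspace_diff subspace_generalized_eigenspace z w)
    ultimately show ?case by blast
  qed
qed

text \<open>
  A \<open>\<mu>\<close> that is not an eigenvalue has trivial generalized eigenspace.  So the restriction to
  eigenvalues in the definition of the stable subspace can be dropped.
\<close>

lemma generalized_eigenspace_stable:
  assumes "Re \<mu> < 0"
  shows "generalized_eigenspace A \<mu> \<subseteq> stable_subspace A"
proof (cases "eigenvalue A \<mu>")
  case True
  with assms show ?thesis
    unfolding stable_subspace_def by (auto intro!: vec.span_base)
next
  case False
  then have inj: "v = 0" if "(A - mat \<mu>) *v v = 0" for v
    using that by (auto simp: eigenvalue_def matrix_vector_mult_diff_rdistrib mat_vector_mult)
  have "v = 0" if "((*v) (A - mat \<mu>) ^^ m) v = 0" for m v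
    using that by (induction m) (auto dest: inj)
  then have "generalized_eigenspace A \<mu> \<subseteq> {0}"
    by (auto simp: generalized_eigenspace_def)
  then show ?thesis
    unfolding stable_subspace_def by (auto intro: vec.span_zero)
qed

lemma subspace_stable_subspace: "vec.subspace (stable_subspace A)"
  unfolding stable_subspace_def by (rule vec.subspace_span)

lemma stable_subspace_induct [consumes 1, case_names subspace generalized_eigenspace]:
  assumes "v \<in> stable_subspace A"
    and "vec.subspace {v. P v}"
    and "\<And>\<mu> v. Re \<mu> < 0 \<Longrightarrow> v \<in> generalized_eigenspace A \<mu> \<Longrightarrow> P v"
  shows "P v"
  using assms(1) unfolding stable_subspace_def
  by (rule vec.span_induct) (use assms(2,3) in auto)

lemma stable_subspace_invariant:
  assumes "v \<in> stable_subspace A"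
  shows "A *v v \<in> stable_subspace A"
  using assms
proof (induction rule: stable_subspace_induct)
  case subspace
  show ?case
    using subspace_stable_subspace [of A]
    by (auto simp: vec.subspace_def matrix_vector_right_distrib vector_scalar_commute)
next
  case (generalized_eigenspace \<mu> v)
  then show ?case
    using generalized_eigenspace_invariant generalized_eigenspace_stable by blast
qed

text \<open>
  The one fact about the stable subspace \<open>\<Sigma>\<close> from which both spectral bounds follow: modulo
  the generalized eigenspace for \<open>\<beta>\<close>, if that is part of \<open>\<Sigma>\<close>, the shift \<open>A - \<beta>\<close> maps \<open>\<Sigma>\<close> onto
  itself.  It is enough to see this on each generalized eigenspace that spans \<open>\<Sigma>\<close>.
\<close>

lemma stable_subspace_decompose:
  assumes "z \<in> stable_subspace A"
  shows "\<exists>w\<in>stable_subspace A. (if Re \<beta> < 0 then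
    z - (A - mat \<beta>) *v w \<in> generalized_eigenspace A \<beta> else z = (A - mat \<beta>) *v w)"
proof -
  define G where "G = (if Re \<beta> < 0 then generalized_eigenspace A \<beta> else {0})"
  have G: "vec.subspace G"
    by (simp add: G_def subspace_generalized_eigenspace vec.subspace_single_0)
  have "\<exists>w\<in>stable_subspace A. z - (A - mat \<beta>) *v w \<in> G"
    using assms
  proof (induction rule: stable_subspace_induct)
    case subspace
    show ?case
    proof (rule vec.subspaceI; clarsimp)
      show "\<exists>w\<in>stable_subspace A. - ((A - mat \<beta>) *v w) \<in> G"
        using vec.subspace_0 [OF G] vec.subspace_0 [OF subspace_stable_subspace] by force
    next
      fix x y w w'
      assume "w \<in> stable_subspace A" "w' \<in> stable_subspace A"
        "x - (A - mat \<beta>) *v w \<in> G" "y - (A - mat \<beta>) *v w' \<in> G"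
      then show "\<exists>w\<in>stable_subspace A. x + y - (A - mat \<beta>) *v w \<in> G"
        using vec.subspace_add [OF G, of "x - (A - mat \<beta>) *v w" "y - (A - mat \<beta>) *v w'"]
        by (intro bexI [of _ "w + w'"] vec.subspace_add subspace_stable_subspace)
           (simp_all add: matrix_vector_right_distrib algebra_simps)
    next
      fix c x w
      assume "w \<in> stable_subspace A" "x - (A - mat \<beta>) *v w \<in> G"
      then show "\<exists>w\<in>stable_subspace A. c *s x - (A - mat \<beta>) *v w \<in> G"
        using vec.subspace_scale [OF G, of "x - (A - mat \<beta>) *v w" c]
        by (intro bexI [of _ "c *s w"] vec.subspace_scale subspace_stable_subspace)
           (simp_all add: vector_scalar_commute vector_ssub_ldistrib)
    qed
  next
    case (generalized_eigenspace \<mu> v)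
    show ?case
    proof (cases "\<beta> = \<mu>")
      case True
      then show ?thesis
        using generalized_eigenspace
        by (intro bexI [of _ 0]) (auto simp: G_def intro: vec.subspace_0 subspace_stable_subspace)
    next
      case False
      then obtain w where "w \<in> generalized_eigenspace A \<mu>" "(A - mat \<beta>) *v w = v"
        using generalized_eigenspace_shift_surj generalized_eigenspace by blast
      then show ?thesis
        using generalized_eigenspace generalized_eigenspace_stable vec.subspace_0 [OF G]
        by (intro bexI [of _ w]) auto
    qed
  qed
  then show ?thesis by (auto simp: G_def split: if_splits)
qed

lemma stable_subspace_shift_surj:
  assumes "z \<in> stable_subspace A" "\<not> Re \<beta> < 0"
  obtains w where "w \<in> stable_subspace A" "(A - mat \<beta>) *v w = z"
  using stable_subspace_decompose [OF assms(1), of \<beta>] assms(2) by auto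

text \<open>
  This says that \<open>A\<close> has no eigenvalue of negative real part modulo the stable subspace: such
  an eigenvector could be corrected within the subspace to a generalized eigenvector, and
  that lies in the subspace already.
\<close>

lemma stable_subspace_shift_vimage:
  assumes "(A - mat \<beta>) *v y \<in> stable_subspace A" "Re \<beta> < 0"
  shows "y \<in> stable_subspace A"
proof -
  obtain w where w: "w \<in> stable_subspace A"
    and "(A - mat \<beta>) *v y - (A - mat \<beta>) *v w \<in> generalized_eigenspace A \<beta>"
    using stable_subspace_decompose [OF assms(1), of \<beta>] assms(2) by auto
  then obtain m where "((*v) (A - mat \<beta>) ^^ m) ((A - mat \<beta>) *v (y - w)) = 0"
    by (auto simp: generalized_eigenspace_def matrix_vector_mult_diff_distrib)
  then have "((*v) (A - mat \<beta>) ^^ Suc m) (y - w) = 0"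
    by (simp only: funpow_Suc_right o_apply)
  then have "y - w \<in> generalized_eigenspace A \<beta>"
    unfolding generalized_eigenspace_def by blast
  then have "y - w \<in> stable_subspace A"
    using generalized_eigenspace_stable assms(2) by blast
  from vec.subspace_add [OF subspace_stable_subspace this w] show ?thesis by simp
qed

lemma range_mult_vector: "range ((*v) (P :: complex^'k^'n)) = vec.span (columns P)"
proof
  show "vec.span (columns P) \<subseteq> range ((*v) P)"
  proof (rule vec.span_minimal)
    show "vec.subspace (range ((*v) P))"
      by (rule vec.subspace_image) (auto intro: vec.subspace_UNIV)
    show "columns P \<subseteq> range ((*v) P)"
    proof -
      have "column i P = P *v axis i 1" for i
        by (simp add: vec_eq_iff matrix_vector_mult_def column_def axis_def if_distrib cong: if_cong)
      then show ?thesis by (auto simp: columns_def)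
    qed
  qed
qed (auto intro: matrix_vector_mult_in_columnspace_gen)

lemma stable_frame:
  fixes P :: "complex^'k^'n"
  assumes "P \<in> stiefel" "vec.span (columns P) = stable_subspace A"
  shows "A ** P = P ** (ctranspose P ** A ** P)"
    and "P *v x \<in> stable_subspace A"
    and "y \<in> stable_subspace A \<Longrightarrow> P *v (ctranspose P *v y) = y"
proof -
  have range: "range ((*v) P) = stable_subspace A"
    using assms(2) by (simp add: range_mult_vector)
  show mem: "P *v x \<in> stable_subspace A" for x
    by (simp flip: range)
  show proj: "P *v (ctranspose P *v y) = y" if "y \<in> stable_subspace A" for y
  proof -
    have "y \<in> range ((*v) P)" by (simp only: range that)
    then obtain x where "y = P *v x" by (rule rangeE)
    moreover have "ctranspose P *v (P *v x) = x"
      using assms(1) by (simp add: stiefel_def matrix_vector_mul_assoc)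
    ultimately show ?thesis by simp
  qed
  have "(A ** P) *v x = (P ** (ctranspose P ** A ** P)) *v x" for x
    using proj [OF stable_subspace_invariant [OF mem [of x]]]
    by (simp add: matrix_vector_mul_assoc [symmetric])
  then show "A ** P = P ** (ctranspose P ** A ** P)"
    by (simp add: matrix_eq)
qed

text \<open>
  For \<open>Re \<beta> \<ge> 0\<close> the map \<open>A - \<beta>\<close> is onto on the stable subspace, so \<open>B - \<beta>\<close>, which is the same
  map in the coordinates given by \<open>P\<close>, is onto; a square matrix that is onto is invertible.
\<close>

lemma eigenvalue_compression:
  fixes P :: "complex^'k^'n"
  assumes P: "P \<in> stiefel" "vec.span (columns P) = stable_subspace A"
    and "eigenvalue (ctranspose P ** A ** P) \<beta>"
  shows "Re \<beta> < 0"
proof (rule ccontr)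
  assume \<beta>: "\<not> Re \<beta> < 0"
  define B where "B = ctranspose P ** A ** P"
  note frame = stable_frame [OF P, folded B_def]
  have PP: "ctranspose P *v (P *v x) = x" for x
    using P(1) by (simp add: stiefel_def matrix_vector_mul_assoc)
  have "\<exists>w. (B - mat \<beta>) *v w = z" for z
  proof -
    obtain u where u: "u \<in> stable_subspace A" "(A - mat \<beta>) *v u = P *v z"
      using stable_subspace_shift_surj [OF frame(2) \<beta>] by metis
    define w where "w = ctranspose P *v u"
    have Pw: "P *v w = u"
      using frame(3) [OF u(1)] by (simp add: w_def)
    have "P *v ((B - mat \<beta>) *v w) = (A - mat \<beta>) *v (P *v w)"
      by (simp add: matrix_vector_mul_assoc cmatrix_simps frame(1) mult_mat_commute)
    then have "P *v ((B - mat \<beta>) *v w) = P *v z"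
      by (simp add: Pw u)
    then show ?thesis by (metis PP)
  qed
  then have "surj ((*v) (B - mat \<beta>))"
    by (metis surjI surj_def)
  then have "invertible (B - mat \<beta>)"
    by (simp add: invertible_right_inverse matrix_right_invertible_surjective)
  with assms(3) show False
    by (simp add: eigenvalue_iff_not_invertible B_def)
qed

text \<open>
  An eigenvector \<open>v\<close> for \<open>\<nu> \<noteq> 0\<close> lies in the range of \<open>Q\<close> and satisfies \<open>Q A v = \<nu> v\<close>, so
  \<open>(A - \<nu>) v\<close> is in the stable subspace.  If \<open>Re \<nu> < 0\<close> then so is \<open>v\<close>, and \<open>Q\<close> kills it.
\<close>

lemma eigenvalue_complement:
  fixes A :: "complex^'n^'n" and P :: "complex^'k^'n"
  defines "Q \<equiv> mat 1 - P ** ctranspose P"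
  assumes P: "P \<in> stiefel" "vec.span (columns P) = stable_subspace A"
    and "eigenvalue (Q ** A ** Q) \<nu>"
  shows "Re \<nu> \<ge> 0"
proof (rule ccontr)
  assume "\<not> Re \<nu> \<ge> 0"
  then have \<nu>: "Re \<nu> < 0" "\<nu> \<noteq> 0" by auto
  note frame = stable_frame [OF P]
  have Q: "Q *v y = y - P *v (ctranspose P *v y)" for y
    by (simp add: Q_def matrix_vector_mult_diff_rdistrib matrix_vector_mul_assoc)
  have Qmem: "y - Q *v y \<in> stable_subspace A" for y
    using frame(2) by (simp add: Q)
  have Qker: "Q *v y = 0" if "y \<in> stable_subspace A" for y
    using frame(3) [OF that] by (simp add: Q)
  have QQ: "Q *v (Q *v y) = Q *v y" for y
    using Qker [OF Qmem [of y]] by (simp add: matrix_vector_mult_diff_distrib)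
  obtain v where v: "v \<noteq> 0" "Q *v (A *v (Q *v v)) = \<nu> *s v"
    using assms(4) by (auto simp: eigenvalue_def matrix_vector_mul_assoc [symmetric])
  then have "v = inverse \<nu> *s (Q *v (A *v (Q *v v)))"
    using \<nu> by (simp add: vector_smult_assoc)
  then have Qv: "Q *v v = v"
    by (metis QQ vector_scalar_commute)
  then have "Q *v (A *v v) = \<nu> *s v" using v by simp
  then have "(A - mat \<nu>) *v v \<in> stable_subspace A"
    using Qmem [of "A *v v"] by (simp add: matrix_vector_mult_diff_rdistrib mat_vector_mult)
  then have "v \<in> stable_subspace A"
    using \<nu>(1) by (rule stable_subspace_shift_vimage)
  then show False using Qker Qv v(1) by simp
qed

lemma eigenvalue_uminus_ctranspose:
  assumes "eigenvalue (- ctranspose B) \<gamma>"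
  shows "eigenvalue B (- cnj \<gamma>)"
  unfolding eigenvalue_iff_not_invertible
proof
  assume "invertible (B - mat (- cnj \<gamma>))"
  then obtain N where "(B - mat (- cnj \<gamma>)) ** N = mat 1"
    by (auto simp: invertible_right_inverse)
  from arg_cong [OF this, of ctranspose]
  have "(- ctranspose N) ** (- ctranspose B - mat \<gamma>) = mat 1"
    by (simp add: ctranspose_simps mat_minus cmatrix_simps)
  then have "invertible (- ctranspose B - mat \<gamma>)"
    by (auto simp: invertible_left_inverse)
  with assms show False by (simp add: eigenvalue_iff_not_invertible)
qed

section \<open>Eigenvalues of backward stable maps\<close>

lemma exp_bounded_backward_imp_zero:
  fixes a n K :: real
  assumes "a < 0" "n \<ge> 0" and K: "\<And>x. x \<le> 0 \<Longrightarrow> exp (a * x) * n \<le> K"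
  shows "n = 0"
proof (rule ccontr)
  assume "n \<noteq> 0"
  then have n: "n > 0" using assms(2) by simp
  have "K \<ge> 0" using K [of 0] n by simp
  \<comment> \<open>chosen such that \<open>a * x = K / n\<close>, where \<open>exp y \<ge> 1 + y\<close> already exceeds the bound\<close>
  define x where "x = K / n / a"
  have "x \<le> 0" unfolding x_def using n \<open>K \<ge> 0\<close> assms(1) by (intro divide_nonneg_neg) auto
  have "1 + K / n \<le> exp (a * x)"
    using exp_ge_add_one_self [of "K / n"] assms(1) by (simp add: x_def)
  then have "(1 + K / n) * n \<le> exp (a * x) * n"
    using n by (intro mult_right_mono) auto
  moreover have "(1 + K / n) * n = n + K"
    using n by (simp add: field_simps)
  ultimately show False using K [OF \<open>x \<le> 0\<close>] n by linarith
qed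

text \<open>
  The two solutions \<open>\<phi>\<close> and \<open>\<psi>\<close> are the real and imaginary parts of \<open>e\<^bsup>\<mu>x\<^esup> (u + \<i> v)\<close>.  Rotating
  back by the angle \<open>Im \<mu> x\<close> recovers \<open>e\<^bsup>Re \<mu> x\<^esup> u\<close> and \<open>e\<^bsup>Re \<mu> x\<^esup> v\<close>, and these are unbounded as
  \<open>x \<rightarrow> - \<infinity>\<close> if \<open>Re \<mu> < 0\<close>.
\<close>

lemma restricted_eigenvalue_nonneg:
  fixes L :: "'a::real_normed_vector \<Rightarrow> 'a"
  assumes V: "subspace V" and L: "linear L"
    and stable: "backward_stable_on V L"
    and "restricted_eigenvalue V L \<mu>"
  shows "Re \<mu> \<ge> 0"
proof (rule ccontr)
  assume neg: "\<not> Re \<mu> \<ge> 0"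
  define a b where "a = Re \<mu>" and "b = Im \<mu>"
  obtain u v where uv: "u \<in> V" "v \<in> V" "(u, v) \<noteq> (0, 0)"
    and Lu: "L u = a *\<^sub>R u - b *\<^sub>R v" and Lv: "L v = b *\<^sub>R u + a *\<^sub>R v"
    using assms(4) by (auto simp: restricted_eigenvalue_def a_def b_def)
  define \<phi> where "\<phi> x = (exp (a * x) * cos (b * x)) *\<^sub>R u - (exp (a * x) * sin (b * x)) *\<^sub>R v" for x
  define \<psi> where "\<psi> x = (exp (a * x) * sin (b * x)) *\<^sub>R u + (exp (a * x) * cos (b * x)) *\<^sub>R v" for x
  have "backward_solution L 0 \<phi>"
    unfolding backward_solution_def \<phi>_def
    by (auto intro!: derivative_eq_intros
        simp: linear_diff [OF L] linear_scale [OF L] Lu Lv algebra_simps)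
  moreover have "\<phi> x \<in> V" for x
    unfolding \<phi>_def by (intro subspace_diff subspace_scale V uv)
  ultimately have "bounded (\<phi> ` {..0})"
    using stable by (auto simp: backward_stable_on_def)
  then obtain K where K: "\<And>x. x \<le> 0 \<Longrightarrow> norm (\<phi> x) \<le> K"
    by (auto simp: bounded_iff)
  have "backward_solution L 0 \<psi>"
    unfolding backward_solution_def \<psi>_def
    by (auto intro!: derivative_eq_intros
        simp: linear_add [OF L] linear_scale [OF L] Lu Lv algebra_simps)
  moreover have "\<psi> x \<in> V" for x
    unfolding \<psi>_def by (intro subspace_add subspace_scale V uv)
  ultimately have "bounded (\<psi> ` {..0})"
    using stable by (auto simp: backward_stable_on_def)
  then obtain K' where K': "\<And>x. x \<le> 0 \<Longrightarrow> norm (\<psi> x) \<le> K'"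
    by (auto simp: bounded_iff)
  have "exp (a * x) * norm u \<le> K + K' \<and> exp (a * x) * norm v \<le> K + K'" if x: "x \<le> 0" for x
  proof -
    have rot: "(c * (e * c) + s * (e * s)) = (e::real)" if "c\<^sup>2 + s\<^sup>2 = 1" for c s e
      using that by algebra
    have "cos (b * x) *\<^sub>R \<phi> x + sin (b * x) *\<^sub>R \<psi> x
        = (cos (b * x) * (exp (a * x) * cos (b * x)) + sin (b * x) * (exp (a * x) * sin (b * x))) *\<^sub>R u"
      by (simp add: \<phi>_def \<psi>_def algebra_simps)
    then have u: "cos (b * x) *\<^sub>R \<phi> x + sin (b * x) *\<^sub>R \<psi> x = exp (a * x) *\<^sub>R u"
      by (simp add: rot)
    have "cos (b * x) *\<^sub>R \<psi> x - sin (b * x) *\<^sub>R \<phi> x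
        = (cos (b * x) * (exp (a * x) * cos (b * x)) + sin (b * x) * (exp (a * x) * sin (b * x))) *\<^sub>R v"
      by (simp add: \<phi>_def \<psi>_def algebra_simps)
    then have v: "cos (b * x) *\<^sub>R \<psi> x - sin (b * x) *\<^sub>R \<phi> x = exp (a * x) *\<^sub>R v"
      by (simp add: rot)
    have contr: "norm (c *\<^sub>R w) \<le> norm w" if "\<bar>c\<bar> \<le> 1" for c and w :: 'a
      using mult_right_mono [OF that, of "norm w"] by simp
    have "norm (exp (a * x) *\<^sub>R u) \<le> norm (\<phi> x) + norm (\<psi> x)"
      unfolding u [symmetric]
      by (intro order_trans [OF norm_triangle_ineq] add_mono contr) auto
    moreover have "norm (exp (a * x) *\<^sub>R v) \<le> norm (\<psi> x) + norm (\<phi> x)"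
      unfolding v [symmetric]
      by (intro order_trans [OF norm_triangle_ineq4] add_mono contr) auto
    ultimately show ?thesis using K [OF x] K' [OF x] by simp
  qed
  then have "norm w = 0" if "w \<in> {u, v}" for w
    using neg that by (intro exp_bounded_backward_imp_zero [of a _ "K + K'"]) (auto simp: a_def)
  then have "norm u = 0" "norm v = 0" by blast+
  with uv(3) show False by simp
qed

lemma coset_of_eq_iff:
  assumes "subspace T"
  shows "coset_of T u = coset_of T v \<longleftrightarrow> u - v \<in> T"
proof
  assume eq: "coset_of T u = coset_of T v"
  have "u \<in> coset_of T u"
    using subspace_0 [OF assms] by (force simp: coset_of_def)
  then show "u - v \<in> T" unfolding eq by (auto simp: coset_of_def)
next
  have sub: "coset_of T u \<subseteq> coset_of T v" if uv: "u - v \<in> T" for u v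
  proof
    fix y assume "y \<in> coset_of T u"
    then obtain t where t: "t \<in> T" "y = u + t" by (auto simp: coset_of_def)
    then have "y = v + (t + (u - v))" "t + (u - v) \<in> T"
      using subspace_add [OF assms _ uv] by auto
    then show "y \<in> coset_of T v" unfolding coset_of_def by blast
  qed
  assume "u - v \<in> T"
  moreover from this have "v - u \<in> T"
    using subspace_neg [OF assms] by fastforce
  ultimately show "coset_of T u = coset_of T v"
    using sub by blast
qed

section \<open>The linearised flow in coordinates\<close>

text \<open>
  The derivative of \<open>X \<mapsto> X\<^sup>* X\<close> at \<open>P\<close> in the direction \<open>\<Omega>\<close>.  Its kernel is the
  tangent space, so it serves as a coordinate on the quotient by the tangent space.
\<close>

definition tangency_defect :: "complex^'k^'n \<Rightarrow> complex^'k^'n \<Rightarrow> complex^'k^'k" where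
  "tangency_defect P \<Omega> = ctranspose P ** \<Omega> + ctranspose \<Omega> ** P"

lemma stiefel_tangent_iff: "\<Omega> \<in> stiefel_tangent P \<longleftrightarrow> tangency_defect P \<Omega> = 0"
  by (simp add: stiefel_tangent_def tangency_defect_def)

lemma bounded_linear_tangency_defect: "bounded_linear (tangency_defect P)"
  unfolding linear_conv_bounded_linear [symmetric]
  by (rule linearI) (simp_all add: tangency_defect_def ctranspose_simps cmatrix_simps algebra_simps)

lemma ctranspose_tangency_defect: "ctranspose (tangency_defect P \<Omega>) = tangency_defect P \<Omega>"
  by (simp add: tangency_defect_def ctranspose_simps add.commute)

text \<open>
  Everything rests on \<open>A P = P B\<close>, which gives \<open>Q A P = 0\<close>: the component of \<open>\<Omega>\<close> along \<open>P\<close> does not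
  feed into the complement.
\<close>

lemma orth_lin_components:
  fixes A :: "complex^'n^'n" and P :: "complex^'k^'n"
  defines "B \<equiv> ctranspose P ** A ** P" and "Q \<equiv> mat 1 - P ** ctranspose P"
  assumes P: "P \<in> stiefel" "vec.span (columns P) = stable_subspace A"
  shows "ctranspose P ** orth_lin A P \<Omega> = - (tangency_defect P \<Omega> ** B)"
    and "Q ** orth_lin A P \<Omega> = (Q ** A ** Q) ** (Q ** \<Omega>) - (Q ** \<Omega>) ** B"
proof -
  have AP: "A ** P = P ** B"
    using stable_frame(1) [OF P] by (simp add: B_def)
  have PP: "ctranspose P ** P = mat 1"
    using P(1) by (simp add: stiefel_def)
  have PQ: "ctranspose P ** Q = 0" and QP: "Q ** P = 0"
    by (simp_all add: Q_def cmatrix_simps matrix_mul_assoc PP)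
       (simp add: matrix_mul_assoc [symmetric] PP)
  have QQ: "Q ** Q = Q"
    by (subst (2) Q_def) (simp add: cmatrix_simps matrix_mul_assoc QP)
  have "\<Omega> ** ctranspose P ** A ** P = \<Omega> ** B"
    by (simp only: B_def matrix_mul_assoc)
  moreover have "P ** ctranspose \<Omega> ** A ** P = P ** (ctranspose \<Omega> ** (P ** B))"
    by (simp only: matrix_mul_assoc [symmetric] AP)
  ultimately have L: "orth_lin A P \<Omega> = Q ** (A ** \<Omega>) - \<Omega> ** B - P ** (ctranspose \<Omega> ** (P ** B))"
    by (simp only: orth_lin_def Q_def matrix_mul_assoc)
  have "ctranspose P ** (Q ** (A ** \<Omega>)) = 0" "ctranspose P ** (P ** X) = X" for X :: "complex^'k^'k"
    by (simp_all add: matrix_mul_assoc PQ PP cmatrix_simps)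
  then show "ctranspose P ** orth_lin A P \<Omega> = - (tangency_defect P \<Omega> ** B)"
    unfolding L by (simp add: tangency_defect_def cmatrix_simps matrix_mul_assoc PP)
  have QA: "Q ** A ** Q = Q ** A"
  proof -
    have "Q ** A ** (P ** ctranspose P) = (Q ** P) ** (B ** ctranspose P)"
      by (metis AP matrix_mul_assoc)
    then show ?thesis
      by (subst (2) Q_def) (simp add: cmatrix_simps QP)
  qed
  have "Q ** (P ** X) = 0" for X :: "complex^'k^'k"
    by (simp add: matrix_mul_assoc QP cmatrix_simps)
  moreover have "(Q ** A ** Q) ** (Q ** \<Omega>) = Q ** (Q ** (A ** \<Omega>))"
    by (metis QA QQ matrix_mul_assoc)
  ultimately show "Q ** orth_lin A P \<Omega> = (Q ** A ** Q) ** (Q ** \<Omega>) - (Q ** \<Omega>) ** B"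
    unfolding L by (simp add: cmatrix_simps matrix_mul_assoc QP)
qed

lemma tangency_defect_orth_lin:
  fixes A :: "complex^'n^'n" and P :: "complex^'k^'n"
  defines "B \<equiv> ctranspose P ** A ** P"
  assumes P: "P \<in> stiefel" "vec.span (columns P) = stable_subspace A"
  shows "tangency_defect P (orth_lin A P \<Omega>)
    = (- ctranspose B) ** tangency_defect P \<Omega> - tangency_defect P \<Omega> ** B"
proof -
  have "tangency_defect P W = ctranspose P ** W + ctranspose (ctranspose P ** W)" for W
    by (simp add: tangency_defect_def ctranspose_simps)
  from this [of "orth_lin A P \<Omega>"] show ?thesis
    unfolding orth_lin_components(1) [OF P]
    by (simp only: ctranspose_simps ctranspose_tangency_defect cmatrix_simps B_def) simp
qed

lemma tangency_flow_stable:
  fixes A :: "complex^'n^'n" and P :: "complex^'k^'n"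
  defines "B \<equiv> ctranspose P ** A ** P"
  assumes P: "P \<in> stiefel" "vec.span (columns P) = stable_subspace A"
  shows "backward_stable_on UNIV (\<lambda>S. (- ctranspose B) ** S - S ** B)"
  unfolding backward_stable_on_def backward_solution_def
proof (intro allI impI, elim conjE)
  fix x0 and S :: "real \<Rightarrow> complex^'k^'k"
  assume S: "\<forall>x\<le>x0. (S has_vector_derivative (- ctranspose B) ** S x - S x ** B) (at x within {..x0})"
  show "bounded (S ` {..x0})"
  proof (rule sylvester_backward_bounded)
    fix \<beta> \<gamma>
    assume "eigenvalue B \<beta>" "eigenvalue (- ctranspose B) \<gamma>"
    then have "Re \<beta> < 0" "Re (- cnj \<gamma>) < 0"
      using eigenvalue_compression [OF P] eigenvalue_uminus_ctranspose unfolding B_def by blast+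
    then show "Re \<beta> < Re \<gamma>" by simp
  qed (use S in auto)
qed

lemma orth_lin_tangent_invariant:
  assumes P: "P \<in> stiefel" "vec.span (columns P) = stable_subspace A"
  shows "orth_lin A P ` stiefel_tangent P \<subseteq> stiefel_tangent P"
  by (auto simp: stiefel_tangent_iff tangency_defect_orth_lin [OF P] cmatrix_simps)

lemma orth_lin_tangent_stable:
  fixes P :: "complex^'k^'n"
  assumes P: "P \<in> stiefel" "vec.span (columns P) = stable_subspace A"
  shows "backward_stable_on (stiefel_tangent P) (orth_lin A P)"
  unfolding backward_stable_on_def backward_solution_def
proof (intro allI impI, elim conjE)
  fix x0 \<Omega>
  assume \<Omega>: "\<forall>x\<le>x0. (\<Omega> has_vector_derivative orth_lin A P (\<Omega> x)) (at x within {..x0})"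
    and tangent: "\<forall>x\<le>x0. \<Omega> x \<in> stiefel_tangent P"
  define Q where "Q = mat 1 - P ** ctranspose P"
  define B where "B = ctranspose P ** A ** P"
  obtain X where X: "\<And>x. x \<in> {..x0} \<Longrightarrow> ctranspose P ** \<Omega> x = X"
  proof (rule has_vector_derivative_zero_constant)
    fix x assume "x \<in> {..x0}"
    then have "((\<lambda>x. ctranspose P ** \<Omega> x) has_vector_derivative ctranspose P ** orth_lin A P (\<Omega> x))
        (at x within {..x0})" "tangency_defect P (\<Omega> x) = 0"
      using \<Omega> tangent by (auto intro: cmatrix_mult_derivative simp: stiefel_tangent_iff)
    then show "((\<lambda>x. ctranspose P ** \<Omega> x) has_vector_derivative 0) (at x within {..x0})"
      by (simp add: orth_lin_components(1) [OF P] cmatrix_simps)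
  qed (use that in auto)
  have Y: "bounded ((\<lambda>x. Q ** \<Omega> x) ` {..x0})"
  proof (rule sylvester_backward_bounded)
    fix x assume "x \<le> x0"
    with \<Omega> have "((\<lambda>x. Q ** \<Omega> x) has_vector_derivative Q ** orth_lin A P (\<Omega> x)) (at x within {..x0})"
      by (auto intro: cmatrix_mult_derivative)
    then show "((\<lambda>x. Q ** \<Omega> x) has_vector_derivative (Q ** A ** Q) ** (Q ** \<Omega> x) - (Q ** \<Omega> x) ** B)
        (at x within {..x0})"
      unfolding Q_def B_def orth_lin_components(2) [OF P] .
  next
    fix \<beta> \<gamma> assume "eigenvalue B \<beta>" "eigenvalue (Q ** A ** Q) \<gamma>"
    then show "Re \<beta> < Re \<gamma>"
      using eigenvalue_compression [OF P] eigenvalue_complement [OF P]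
      unfolding B_def Q_def by (meson order_less_le_trans)
  qed
  have "bounded ((\<lambda>x. P ** X + Q ** \<Omega> x) ` {..x0})"
    by (intro bounded_plus_comp Y) (simp add: image_constant_conv)
  moreover have "\<Omega> x = P ** X + Q ** \<Omega> x" if "x \<le> x0" for x
    using X [of x] that by (simp add: Q_def cmatrix_simps matrix_mul_assoc [symmetric])
  then have "\<Omega> ` {..x0} = (\<lambda>x. P ** X + Q ** \<Omega> x) ` {..x0}"
    by (intro image_cong) auto
  ultimately show "bounded (\<Omega> ` {..x0})" by (simp only:)
qed

lemma tangency_defect_frame:
  assumes "P \<in> stiefel"
  shows "tangency_defect P (P ** S) = S + ctranspose S"
  using assms
  by (simp add: tangency_defect_def stiefel_def ctranspose_mult matrix_mul_assoc)
     (simp add: matrix_mul_assoc [symmetric])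

text \<open>
  Subtracting \<open>(1/2) P S\<close>, with \<open>S\<close> the defect of \<open>\<Omega>\<close>, produces a tangent matrix, because \<open>S\<close> is
  Hermitian.
\<close>

lemma infdist_stiefel_tangent_le:
  fixes P :: "complex^'k^'n"
  assumes "P \<in> stiefel"
  shows "infdist \<Omega> (stiefel_tangent P) \<le> norm (P ** tangency_defect P \<Omega>)"
proof -
  let ?S = "tangency_defect P \<Omega>"
  define W where "W = (1/2) *\<^sub>R (P ** ?S)"
  have "tangency_defect P W = (1/2) *\<^sub>R (?S + ?S)"
    by (simp only: W_def linear_scale [OF bounded_linear.linear [OF bounded_linear_tangency_defect]]
        tangency_defect_frame [OF assms] ctranspose_tangency_defect)
  then have "tangency_defect P (\<Omega> - W) = 0"
    by (simp add: linear_diff [OF bounded_linear.linear [OF bounded_linear_tangency_defect]]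
        scaleR_add_right flip: scaleR_add_left)
  then have "infdist \<Omega> (stiefel_tangent P) \<le> dist \<Omega> (\<Omega> - W)"
    by (intro infdist_le) (simp add: stiefel_tangent_iff)
  also have "\<dots> \<le> norm (P ** ?S)"
    by (simp add: dist_norm W_def)
  finally show ?thesis .
qed

lemma orth_lin_transverse_stable:
  fixes P :: "complex^'k^'n"
  assumes P: "P \<in> stiefel" "vec.span (columns P) = stable_subspace A"
  shows "backward_stable_transverse (stiefel_tangent P) (orth_lin A P)"
  unfolding backward_stable_transverse_def
proof (intro allI impI)
  fix x0 \<Omega>
  assume \<Omega>: "backward_solution (orth_lin A P) x0 \<Omega>"
  define S where "S x = tangency_defect P (\<Omega> x)" for x
  have "bounded (S ` {..x0})"
    using tangency_flow_stable [OF P] \<Omega>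
      bounded_linear.has_vector_derivative [OF bounded_linear_tangency_defect [of P]]
    unfolding backward_stable_on_def backward_solution_def S_def
    by (auto simp: tangency_defect_orth_lin [OF P, symmetric])
  then have "bounded ((\<lambda>x. P ** S x) ` {..x0})"
    by (rule bounded_matrix_mult)
  then obtain K where "\<And>x. x \<le> x0 \<Longrightarrow> norm (P ** S x) \<le> K"
    by (auto simp: bounded_iff)
  then have "norm (infdist (\<Omega> x) (stiefel_tangent P)) \<le> K" if "x \<le> x0" for x
    using infdist_stiefel_tangent_le [OF P(1), of "\<Omega> x"] that infdist_nonneg [of "\<Omega> x"]
    unfolding S_def by (metis abs_of_nonneg order_trans real_norm_def)
  then show "bounded ((\<lambda>x. infdist (\<Omega> x) (stiefel_tangent P)) ` {..x0})"
    by (auto simp: bounded_iff)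
qed

text \<open>
  The defect identifies the quotient by the tangent space with a space of Hermitian matrices
  and the induced map with the Sylvester operator there.
\<close>

lemma transverse_eigenvalue_tangency:
  fixes A :: "complex^'n^'n" and P :: "complex^'k^'n"
  defines "B \<equiv> ctranspose P ** A ** P"
  assumes P: "P \<in> stiefel" "vec.span (columns P) = stable_subspace A"
    and "transverse_eigenvalue (stiefel_tangent P) (orth_lin A P) \<mu>"
  shows "restricted_eigenvalue UNIV (\<lambda>S. (- ctranspose B) ** S - S ** B) \<mu>"
proof -
  let ?T = "stiefel_tangent P" and ?\<phi> = "tangency_defect P"
  note lin = bounded_linear.linear [OF bounded_linear_tangency_defect]
  note T = subspace_stiefel_tangent [of P]
  have coset: "coset_of ?T u = coset_of ?T v \<longleftrightarrow> ?\<phi> u = ?\<phi> v" for u v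
    by (simp add: coset_of_eq_iff [OF T] stiefel_tangent_iff linear_diff [OF lin])
  obtain u v where "(?\<phi> u, ?\<phi> v) \<noteq> (0, 0)"
    and "?\<phi> (orth_lin A P u) = ?\<phi> (Re \<mu> *\<^sub>R u - Im \<mu> *\<^sub>R v)"
    and "?\<phi> (orth_lin A P v) = ?\<phi> (Im \<mu> *\<^sub>R u + Re \<mu> *\<^sub>R v)"
    using assms(4)
    unfolding transverse_eigenvalue_def
      quotient_map_coset_of [OF T linear_orth_lin orth_lin_tangent_invariant [OF P]]
    by (auto simp: coset linear_0 [OF lin])
  then show ?thesis
    unfolding restricted_eigenvalue_def
    by (intro bexI [of _ "?\<phi> u"] bexI [of _ "?\<phi> v"])
       (auto simp: tangency_defect_orth_lin [OF P] B_def
         linear_diff [OF lin] linear_add [OF lin] linear_scale [OF lin])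
qed

theorem mainTheorem4:
  fixes Ap :: "complex^'n^'n" and Op :: "complex^'k^'n"
  assumes dim: "vec.dim (stable_subspace Ap) = CARD('k)"
    and orthonormal: "Op \<in> stiefel"
    and spanning: "vec.span (columns Op) = stable_subspace Ap"
  shows
    "(orth_lin Ap Op ` stiefel_tangent Op \<subseteq> stiefel_tangent Op
      \<and> (\<forall>\<mu>. restricted_eigenvalue (stiefel_tangent Op) (orth_lin Ap Op) \<mu>
             \<longrightarrow> Re \<mu> = 0 \<or> Re \<mu> > 0)
      \<and> backward_stable_on (stiefel_tangent Op) (orth_lin Ap Op))
     \<and>
     ((\<forall>\<mu>. transverse_eigenvalue (stiefel_tangent Op) (orth_lin Ap Op) \<mu>
             \<longrightarrow> Re \<mu> = 0 \<or> Re \<mu> > 0)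
      \<and> backward_stable_transverse (stiefel_tangent Op) (orth_lin Ap Op))"
proof -
  note P = orthonormal spanning
  have tangent: "Re \<mu> \<ge> 0"
    if "restricted_eigenvalue (stiefel_tangent Op) (orth_lin Ap Op) \<mu>" for \<mu>
    using subspace_stiefel_tangent linear_orth_lin orth_lin_tangent_stable [OF P] that
    by (rule restricted_eigenvalue_nonneg)
  have "linear (\<lambda>S. (- ctranspose B) ** S - S ** B)" for B :: "complex^'k^'k"
    by (rule linearI) (simp_all add: cmatrix_simps scaleR_diff_right)
  then have transverse: "Re \<mu> \<ge> 0"
    if "transverse_eigenvalue (stiefel_tangent Op) (orth_lin Ap Op) \<mu>" for \<mu>
    using tangency_flow_stable [OF P] transverse_eigenvalue_tangency [OF P that]
    by (rule restricted_eigenvalue_nonneg [OF subspace_UNIV])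
  show ?thesis
    using tangent transverse orth_lin_tangent_invariant [OF P] orth_lin_tangent_stable [OF P]
      orth_lin_transverse_stable [OF P]
    by (auto simp: less_le)
qed

end
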